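(* Let $\theta=(\theta_{j+\frac12})_{j=1}^n$ be the turning angles of a cooriented $n$-gon ($n\ge3$), and let $\mathcal P_\theta:\mathbb R^n\to\mathbb R^n$ be the linear map $p\mapsto p^*$ given by $$(\mathcal P_\theta p)_j=\tfrac12\bigl(-\csc\theta_{j-\frac12}\,p_{j-1}+(\cot\theta_{j-\frac12}-\cot\theta_{j+\frac12})\,p_j+\csc\theta_{j+\frac12}\,p_{j+1}\bigr)$$ (indices modulo $n$). Then the (complex) spectrum of $\mathcal P_\theta$ is symmetric with respect to the origin. Moreover, opposite eigenvalues $\lambda$ and $-\lambda$ have the same geometric multiplicity and the same sizes of Jordan blocks.
   Context: A cooriented $n$-gon is a cyclic sequence of cooriented lines $l_j=(\alpha_j,p_j)$, i.e. lines $x\cos\alpha_j+y\sin\alpha_j=p_j$ with coorienting normal $(\cos\alpha_j,\sin\alpha_j)$, such that consecutive lines are not parallel. Its turning angles are $\theta_{j+\frac12}\equiv\alpha_{j+1}-\alpha_j\pmod{2\pi}$; hence $\theta_{j+\frac12}\not\equiv0\pmod\pi$ and $\sum_j\theta_{j+\frac12}\in2\pi\mathbb Z$. The map $\mathcal P_\theta$ describes how the support numbers $p=(p_1,\dots,p_n)$ change when the polygon is replaced by its perpendicular bisector evolute (whose sides are the perpendicular bisectors of the sides of the polygon). *)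

theory Defs
  imports
    "HOL-Analysis.Analysis"
    "HOL-Library.Real_Mod"
    "Jordan_Normal_Form.Jordan_Normal_Form_Uniqueness"
    "Jordan_Normal_Form.Spectral_Radius"
begin

text \<open>
  A cooriented line is a pair \<open>(\<alpha>, p)\<close> of the angle of its normal and its support number.
\<close>

type_synonym cooriented_line = "real \<times> real"

definition line_points :: "cooriented_line \<Rightarrow> (real \<times> real) set" where
  "line_points l = {(x, y). x * cos (fst l) + y * sin (fst l) = snd l}"

text \<open>Coinciding lines count as parallel.\<close>

definition parallel_lines :: "cooriented_line \<Rightarrow> cooriented_line \<Rightarrow> bool" where
  "parallel_lines l m \<longleftrightarrow> line_points l = line_points m \<or> line_points l \<inter> line_points m = {}"

text \<open>
  The sides of an \<open>n\<close>-gon are indexed by \<open>0, \<dots>, n - 1\<close>, cyclically.  A half-integer index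
  \<open>j + 1/2\<close> is represented by \<open>j\<close>, so that \<open>\<theta> j\<close> is the turning angle from side \<open>j\<close>
  to side \<open>j + 1\<close>, and the angle with index \<open>j - 1/2\<close> is \<open>\<theta> ((j + n - 1) mod n)\<close>.
\<close>

definition cooriented_polygon :: "nat \<Rightarrow> (nat \<Rightarrow> cooriented_line) \<Rightarrow> bool" where
  "cooriented_polygon n l \<longleftrightarrow> (\<forall>j<n. \<not> parallel_lines (l j) (l (Suc j mod n)))"

definition turning_angles :: "nat \<Rightarrow> (nat \<Rightarrow> cooriented_line) \<Rightarrow> (nat \<Rightarrow> real) \<Rightarrow> bool" where
  "turning_angles n l \<theta> \<longleftrightarrow>
     (\<forall>j<n. [\<theta> j = fst (l (Suc j mod n)) - fst (l j)] (rmod 2 * pi))"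

definition csc :: "real \<Rightarrow> real" where
  "csc x = 1 / sin x"

definition evolute_map :: "nat \<Rightarrow> (nat \<Rightarrow> real) \<Rightarrow> real vec \<Rightarrow> real vec" where
  "evolute_map n \<theta> p = vec n (\<lambda>j.
     let prev = (j + n - 1) mod n; succ = Suc j mod n in
     1 / 2 * (- csc (\<theta> prev) * p $ prev + (cot (\<theta> prev) - cot (\<theta> j)) * p $ j
              + csc (\<theta> j) * p $ succ))"

text \<open>The matrix of \<open>evolute_map\<close> in the standard basis, over the complex numbers.\<close>

definition evolute_mat :: "nat \<Rightarrow> (nat \<Rightarrow> real) \<Rightarrow> complex mat" where
  "evolute_mat n \<theta> =
     map_mat complex_of_real (mat n n (\<lambda>(i, j). evolute_map n \<theta> (unit_vec n j) $ i))"

definition geometric_multiplicity :: "complex mat \<Rightarrow> complex \<Rightarrow> nat" where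
  "geometric_multiplicity A ev = kernel_dim (char_matrix A ev)"

text \<open>
  The multiset of the sizes of the blocks with eigenvalue \<open>ev\<close> in a Jordan normal form given,
  as in \<open>jordan_nf\<close>, by a list of pairs of block size and eigenvalue.
\<close>

definition block_sizes :: "(nat \<times> complex) list \<Rightarrow> complex \<Rightarrow> nat multiset" where
  "block_sizes bs ev = image_mset fst (filter_mset (\<lambda>b. snd b = ev) (mset bs))"

lemma parallel_lines_iff_sin:
  "parallel_lines l m \<longleftrightarrow> sin (fst m - fst l) = 0"
proof -
  obtain a p where l: "l = (a, p)" by (cases l)
  obtain b q where m: "m = (b, q)" by (cases m)
  define D where "D = sin (b - a)"
  have D: "D = cos a * sin b - sin a * cos b"
    by (simp add: D_def sin_diff algebra_simps)
  have sc: "sin a * sin a + cos a * cos a = 1" "sin b * sin b + cos b * cos b = 1"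
    using sin_cos_squared_add[of a] sin_cos_squared_add[of b] by (simp_all add: power2_eq_square)
  show ?thesis
  proof (cases "D = 0")
    case False
    define x where "x = (p * sin b - q * sin a) / D"
    define y where "y = (q * cos a - p * cos b) / D"
    have "x * cos a + y * sin a = ((p * sin b - q * sin a) * cos a + (q * cos a - p * cos b) * sin a) / D"
      by (simp add: x_def y_def add_divide_distrib)
    also have "\<dots> = (p * D) / D"
      by (rule arg_cong[of _ _ "\<lambda>t. t / D"]) (simp add: D algebra_simps)
    finally have 1: "x * cos a + y * sin a = p" using False by simp
    have "x * cos b + y * sin b = ((p * sin b - q * sin a) * cos b + (q * cos a - p * cos b) * sin b) / D"
      by (simp add: x_def y_def add_divide_distrib)
    also have "\<dots> = (q * D) / D"
      by (rule arg_cong[of _ _ "\<lambda>t. t / D"]) (simp add: D algebra_simps)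
    finally have 2: "x * cos b + y * sin b = q" using False by simp
    have in_both: "(x, y) \<in> line_points l \<inter> line_points m"
      using 1 2 by (simp add: line_points_def l m)
    have "(x - sin a, y + cos a) \<in> line_points l"
      using 1 by (simp add: line_points_def l algebra_simps)
    moreover have "(x - sin a) * cos b + (y + cos a) * sin b = q + D"
      using 2 unfolding D by (simp add: algebra_simps)
    then have "(x - sin a, y + cos a) \<notin> line_points m"
      using False by (simp add: line_points_def m)
    ultimately have "\<not> parallel_lines l m"
      using in_both unfolding parallel_lines_def by blast
    then show ?thesis using False by (simp add: D_def l m)
  next
    case True
    define c where "c = cos (b - a)"
    have cb: "cos b = c * cos a" and sb: "sin b = c * sin a"
      using cos_add[of "b - a" a] sin_add[of "b - a" a] True by (simp_all add: c_def D_def)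
    have c0: "c \<noteq> 0" using sc(2) cb sb by auto
    have *: "x * cos b + y * sin b = c * (x * cos a + y * sin a)" for x y
      by (simp add: cb sb algebra_simps)
    have "parallel_lines l m"
    proof (cases "q = c * p")
      case True
      then have "line_points l = line_points m"
        using c0 by (auto simp: line_points_def l m *)
      then show ?thesis by (simp add: parallel_lines_def)
    next
      case False
      then have "line_points l \<inter> line_points m = {}"
        by (auto simp: line_points_def l m *)
      then show ?thesis by (simp add: parallel_lines_def)
    qed
    then show ?thesis using True by (simp add: D_def l m)
  qed
qed

lemma evolute_mat_mult_vec:
  assumes p: "p \<in> carrier_vec n"
  shows "evolute_mat n \<theta> *\<^sub>v map_vec complex_of_real p
       = map_vec complex_of_real (evolute_map n \<theta> p)"
proof (rule eq_vecI)
  fix i assume "i < dim_vec (map_vec complex_of_real (evolute_map n \<theta> p))"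
  then have i: "i < n" by (simp add: evolute_map_def)
  define k where "k = (i + n - 1) mod n"
  define s where "s = Suc i mod n"
  have ks: "k < n" "s < n" using i by (simp_all add: k_def s_def)
  have entry: "evolute_map n \<theta> q $ i
      = - csc (\<theta> k) / 2 * q $ k + (cot (\<theta> k) - cot (\<theta> i)) / 2 * q $ i + csc (\<theta> i) / 2 * q $ s"
    for q
    using i unfolding evolute_map_def Let_def k_def[symmetric] s_def[symmetric]
    by (simp only: index_vec k_def[symmetric] s_def[symmetric]) (simp add: field_simps)
  have delta: "(\<Sum>j = 0..<n. (c * unit_vec n j $ m) * p $ j) = c * p $ m" if "m < n" for c m
  proof -
    have "(\<Sum>j = 0..<n. (c * unit_vec n j $ m) * p $ j) = (\<Sum>j = 0..<n. if j = m then c * p $ m else 0)"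
      using that by (intro sum.cong) (auto simp: unit_vec_def)
    then show ?thesis using that by simp
  qed
  have "(\<Sum>j = 0..<n. evolute_map n \<theta> (unit_vec n j) $ i * p $ j)
      = (\<Sum>j = 0..<n. (- csc (\<theta> k) / 2 * unit_vec n j $ k) * p $ j
          + ((cot (\<theta> k) - cot (\<theta> i)) / 2 * unit_vec n j $ i) * p $ j
          + (csc (\<theta> i) / 2 * unit_vec n j $ s) * p $ j)"
    unfolding entry by (simp only: distrib_right)
  also have "\<dots> = - csc (\<theta> k) / 2 * p $ k + (cot (\<theta> k) - cot (\<theta> i)) / 2 * p $ i
      + csc (\<theta> i) / 2 * p $ s"
    unfolding sum.distrib delta[OF ks(1)] delta[OF ks(2)] delta[OF i] by (rule refl)
  also have "\<dots> = evolute_map n \<theta> p $ i"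
    by (simp only: entry)
  finally have "complex_of_real (\<Sum>j = 0..<n. evolute_map n \<theta> (unit_vec n j) $ i * p $ j)
      = complex_of_real (evolute_map n \<theta> p $ i)" by simp
  then show "(evolute_mat n \<theta> *\<^sub>v map_vec complex_of_real p) $ i
      = map_vec complex_of_real (evolute_map n \<theta> p) $ i"
    using i p by (simp add: evolute_mat_def scalar_prod_def evolute_map_def)
qed (simp add: evolute_mat_def evolute_map_def)

lemma evolute_mat_jordan_nf_exists: "\<exists>bs. jordan_nf (evolute_mat n \<theta>) bs"
proof -
  have A: "evolute_mat n \<theta> \<in> carrier_mat n n" by (simp add: evolute_mat_def)
  show ?thesis using char_poly_factorized[OF A] jordan_nf_exists[OF A] by blast
qed

end

theory Submission
  imports Defs
begin

text \<open>
  On side \<open>j\<close>, let \<open>(F p)\<^sub>j\<close> and \<open>(G p)\<^sub>j\<close> be the signed coordinates of the vertices shared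
  with sides \<open>j + 1\<close> and \<open>j - 1\<close>, measured from the foot of the perpendicular from the origin.
  Then \<open>P = (F + G) / 2\<close> is the evolute map and \<open>L = F - G\<close> gives the side lengths.  The matrix
  \<open>L\<close> is symmetric, and computing the squared norm of each vertex from its two sides gives
  \<open>F\<^sup>T F = G\<^sup>T G\<close>; together these yield \<open>L P = - P\<^sup>T L\<close>.  On the kernel of \<open>L\<close> (all sides through
  one point) \<open>P\<close> is a quarter turn, so \<open>P\<^sup>2 = - 1\<close> there.

  If \<open>\<lambda>\<^sup>2 \<noteq> - 1\<close>, then \<open>L\<close> maps the kernel of \<open>(P - \<lambda>)\<^sup>k\<close> injectively into that of
  \<open>(P\<^sup>T + \<lambda>)\<^sup>k\<close>; since \<open>P\<^sup>T\<close> is similar to \<open>P\<close>, the generalized eigenspaces at \<open>\<lambda>\<close> and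
  \<open>- \<lambda>\<close> have equal dimensions.  The remaining eigenvalues \<open>\<plusminus> \<i>\<close> are exchanged by complex
  conjugation, under which \<open>P\<close> is invariant.  The dimensions determine the block sizes.
\<close>

subsection \<open>Generalized eigenspaces and Jordan blocks\<close>

text \<open>An injective linear map carries a basis of the first kernel to an independent family in
  the second. Injectivity is asked for only on the kernel of \<open>A\<close>, so \<open>L\<close>
  may be singular on the whole space.\<close>

lemma kernel_dim_le_of_injective:
  fixes A B L :: "'a::field mat"
  assumes A: "A \<in> carrier_mat r n" and B: "B \<in> carrier_mat q m" and L: "L \<in> carrier_mat m n"
    and maps: "\<And>x. x \<in> mat_kernel A \<Longrightarrow> L *\<^sub>v x \<in> mat_kernel B"
    and inj: "\<And>x. x \<in> mat_kernel A \<Longrightarrow> L *\<^sub>v x = 0\<^sub>v m \<Longrightarrow> x = 0\<^sub>v n"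
  shows "kernel_dim A \<le> kernel_dim B"
proof -
  interpret A: kernel r n A by unfold_locales (rule A)
  interpret B: kernel q m B by unfold_locales (rule B)
  have carr: "x \<in> carrier_vec n" if "x \<in> mat_kernel A" for x
    using mat_kernelD[OF A that] by simp
  interpret lm: linear_map class_ring A.VK B.VK "(*\<^sub>v) L"
    apply unfold_locales
    unfolding LinearCombinations.module_hom_def
    using maps carr L
    by (auto simp: class_ring_simps mult_add_distrib_mat_vec[OF L] mult_mat_vec[OF L])
  have i: "inj_on ((*\<^sub>v) L) (carrier A.VK)"
  proof (rule inj_onI)
    fix x y assume x: "x \<in> carrier A.VK" and y: "y \<in> carrier A.VK" and e: "L *\<^sub>v x = L *\<^sub>v y"
    have xy: "x \<in> mat_kernel A" "y \<in> mat_kernel A" "x \<in> carrier_vec n" "y \<in> carrier_vec n"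
      using x y carr by auto
    have "x - y \<in> mat_kernel A"
      using xy mat_kernelD[OF A] A
      by (intro mat_kernelI[OF A]) (auto simp: mult_minus_distrib_mat_vec)
    moreover have "L *\<^sub>v (x - y) = 0\<^sub>v m"
      using xy e L by (simp add: mult_minus_distrib_mat_vec)
    ultimately have "x - y = 0\<^sub>v n"
      by (rule inj)
    then show "x = y"
      using xy by (auto simp: vec_eq_iff)
  qed
  have fb: "B.Ker.fin_dim"
    using kernel_basis_exists[OF B] unfolding B.Ker.fin_dim_def B.Ker.basis_def by auto
  obtain bas where bas: "finite bas" "A.Ker.basis bas"
    using kernel_basis_exists[OF A] by blast
  have bas': "bas \<subseteq> carrier A.VK" "A.Ker.lin_indpt bas"
    using bas(2) by (auto simp: A.Ker.basis_def)
  have "B.Ker.lin_indpt ((*\<^sub>v) L ` bas)"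
  proof
    assume "B.Ker.lin_dep ((*\<^sub>v) L ` bas)"
    then obtain U a v where U: "finite U" "U \<subseteq> (*\<^sub>v) L ` bas" "B.Ker.lincomb a U = 0\<^sub>v m" "v \<in> U" "a v \<noteq> 0"
      unfolding B.Ker.lin_dep_def by auto
    \<comment> \<open>The relation among the images is pulled back: each vector of \<open>V\<close>
      receives the coefficient of its image, and \<open>L\<close> sends the resulting combination to
      zero.\<close>
    obtain V where V: "V \<subseteq> bas" "U = (*\<^sub>v) L ` V"
      using U(2) by (meson subset_imageE)
    have fV: "finite V"
      using V(1) bas(1) finite_subset by blast
    have VA: "V \<subseteq> mat_kernel A" using V(1) bas'(1) by auto
    have closed: "A.Ker.lincomb (a \<circ> (*\<^sub>v) L) V \<in> mat_kernel A"
      by (rule A.Ker.lincomb_closed[OF VA]) simp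
    have "L *\<^sub>v A.Ker.lincomb (a \<circ> (*\<^sub>v) L) V = 0\<^sub>v m"
      using lm.lincomb_linear_image[OF i _ _ fV, of a] VA U(3) V(2) by (simp add: class_ring_simps)
    then have "A.Ker.lincomb (a \<circ> (*\<^sub>v) L) V = 0\<^sub>v n"
      using inj closed by blast
    moreover obtain u where "u \<in> V" "(a \<circ> (*\<^sub>v) L) u \<noteq> 0"
      using U(4,5) V(2) by auto
    ultimately have "A.Ker.lin_dep bas"
      unfolding A.Ker.lin_dep_def using fV V(1)
      by (intro exI[of _ V] exI[of _ "a \<circ> (*\<^sub>v) L"] exI[of _ u]) auto
    then show False using bas'(2) by simp
  qed
  then have "card ((*\<^sub>v) L ` bas) \<le> B.Ker.dim"
    using B.Ker.li_le_dim(2)[OF fb, of "(*\<^sub>v) L ` bas"] bas'(1) maps by auto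
  moreover have "card ((*\<^sub>v) L ` bas) = A.Ker.dim"
    using A.Ker.dim_basis[OF bas] card_image[OF inj_on_subset[OF i bas'(1)]] by simp
  ultimately show ?thesis by simp
qed

lemma similar_mat_transpose_jordan_block:
  "similar_mat (jordan_block n (a :: 'a::comm_ring_1))\<^sup>T (jordan_block n a)"
proof -
  \<comment> \<open>Reversing the order of the basis transposes a Jordan block.\<close>
  define R :: "'a mat" where "R = mat n n (\<lambda>(i, j). of_bool (i + j + 1 = n))"
  have R: "R \<in> carrier_mat n n" by (simp add: R_def)
  have left: "R * A = mat n n (\<lambda>(i, j). A $$ (n - 1 - i, j))" if A: "A \<in> carrier_mat n n" for A
  proof (rule eq_matI)
    fix i j assume ij: "i < dim_row (mat n n (\<lambda>(i, j). A $$ (n - 1 - i, j)))"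
      "j < dim_col (mat n n (\<lambda>(i, j). A $$ (n - 1 - i, j)))"
    then have ind: "Suc (i + k) = n \<longleftrightarrow> k = n - 1 - i" for k by auto
    have "(R * A) $$ (i, j) = (\<Sum>k = 0..<n. R $$ (i, k) * A $$ (k, j))"
      using ij A R by (simp add: scalar_prod_def)
    also have "\<dots> = (\<Sum>k = 0..<n. if k = n - 1 - i then A $$ (n - 1 - i, j) else 0)"
      using ij by (intro sum.cong) (auto simp: R_def ind)
    finally show "(R * A) $$ (i, j) = mat n n (\<lambda>(i, j). A $$ (n - 1 - i, j)) $$ (i, j)"
      using ij by simp
  qed (use A R in auto)
  have right: "A * R = mat n n (\<lambda>(i, j). A $$ (i, n - 1 - j))" if A: "A \<in> carrier_mat n n" for A
  proof (rule eq_matI)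
    fix i j assume ij: "i < dim_row (mat n n (\<lambda>(i, j). A $$ (i, n - 1 - j)))"
      "j < dim_col (mat n n (\<lambda>(i, j). A $$ (i, n - 1 - j)))"
    then have ind: "Suc (k + j) = n \<longleftrightarrow> k = n - 1 - j" for k by auto
    have "(A * R) $$ (i, j) = (\<Sum>k = 0..<n. A $$ (i, k) * R $$ (k, j))"
      using ij A R by (simp add: scalar_prod_def)
    also have "\<dots> = (\<Sum>k = 0..<n. if k = n - 1 - j then A $$ (i, n - 1 - j) else 0)"
      using ij by (intro sum.cong) (auto simp: R_def ind)
    finally show "(A * R) $$ (i, j) = mat n n (\<lambda>(i, j). A $$ (i, n - 1 - j)) $$ (i, j)"
      using ij by simp
  qed (use A R in auto)
  \<comment> \<open>\<open>R\<close> is its own inverse, so multiplying by it on both sides is a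
    similarity.\<close>
  have RR: "R * R = 1\<^sub>m n"
    unfolding left[OF R] by (rule eq_matI) (auto simp: R_def)
  have "(jordan_block n a)\<^sup>T = R * jordan_block n a * R"
    by (subst right, use R in simp, subst left, simp, rule eq_matI) auto
  then show ?thesis
    using R RR by (intro similar_matI[of _ _ R R n]) auto
qed

text \<open>Transposition acts on a block diagonal matrix block by block, and similarities of the
  blocks assemble to one of the whole matrix.\<close>

lemma similar_mat_transpose_jordan_matrix:
  "similar_mat (jordan_matrix (bs :: (nat \<times> 'a::comm_ring_1) list))\<^sup>T (jordan_matrix bs)"
proof (induction bs)
  case Nil
  show ?case by (auto simp: jordan_matrix_def intro!: similar_mat_refl)
next
  case (Cons b bs)
  obtain k a where b: "b = (k, a)" by (cases b)
  show ?case
    unfolding b jordan_matrix_Cons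
    by (subst transpose_four_block_mat)
       (auto intro!: similar_mat_four_block_0_0[OF similar_mat_transpose_jordan_block Cons.IH])
qed

text \<open>Transposing a factorization A = P J Q exchanges the roles of P and Q, so the transpose
  of A is similar to that of its Jordan matrix J, and therefore to J.\<close>

lemma similar_mat_transpose:
  fixes A :: "'a::field mat"
  assumes "jordan_nf A bs"
  shows "similar_mat A\<^sup>T A"
proof -
  have sim: "similar_mat A (jordan_matrix bs)"
    using assms by (simp add: jordan_nf_def)
  from similar_matD[OF this] obtain n P Q where
    *: "{A, jordan_matrix bs, P, Q} \<subseteq> carrier_mat n n" "P * Q = 1\<^sub>m n" "Q * P = 1\<^sub>m n"
       "A = P * jordan_matrix bs * Q" by blast
  have "similar_mat A\<^sup>T (jordan_matrix bs)\<^sup>T"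
  proof (rule similar_matI[of _ _ "Q\<^sup>T" "P\<^sup>T" n])
    have J: "jordan_matrix bs \<in> carrier_mat n n" and P: "P \<in> carrier_mat n n" and Q: "Q \<in> carrier_mat n n" 
      using * by auto
    show "Q\<^sup>T * P\<^sup>T = 1\<^sub>m n" "P\<^sup>T * Q\<^sup>T = 1\<^sub>m n"
      using *(2,3) P Q by (simp_all flip: transpose_mult)
    show "A\<^sup>T = Q\<^sup>T * (jordan_matrix bs)\<^sup>T * P\<^sup>T"
      using J P Q by (simp add: *(4) transpose_mult[of _ n n _ n] assoc_mult_mat[of _ n n _ n _ n])
  qed (use * in auto)
  then show ?thesis
    using similar_mat_transpose_jordan_matrix sim similar_mat_trans similar_mat_sym by blast
qed

text \<open>Conjugation is a ring homomorphism, so applied entrywise it preserves similarity; in a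
  Jordan matrix it changes only the diagonal.\<close>

lemma jordan_nf_cnj:
  assumes "jordan_nf A bs"
  shows "jordan_nf (map_mat cnj A) (map (apsnd cnj) bs)"
proof -
  interpret cnj: comm_ring_hom cnj by unfold_locales auto
  have J: "map_mat cnj (jordan_matrix bs) = jordan_matrix (map (apsnd cnj) bs)" for bs :: "(nat \<times> complex) list"
  proof (induction bs)
    case Nil
    show ?case by (rule eq_matI) (auto simp: jordan_matrix_def)
  next
    case (Cons b bs)
    obtain k a where b: "b = (k, a)" by (cases b)
    have "map_mat cnj (jordan_block k a) = jordan_block k (cnj a)"
      by (rule eq_matI) auto
    then show ?case
      unfolding b apsnd_conv list.map jordan_matrix_Cons Cons.IH[symmetric]
      by (subst map_four_block_mat) (auto simp: o_def)
  qed
  have "similar_mat A (jordan_matrix bs)"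
    using assms by (simp add: jordan_nf_def)
  from similar_matD[OF this] obtain n P Q where
    *: "{A, jordan_matrix bs, P, Q} \<subseteq> carrier_mat n n" "P * Q = 1\<^sub>m n" "Q * P = 1\<^sub>m n"
       "A = P * jordan_matrix bs * Q" by blast
  have "similar_mat (map_mat cnj A) (map_mat cnj (jordan_matrix bs))"
  proof (rule similar_matI[of _ _ "map_mat cnj P" "map_mat cnj Q" n])
    have JPQ: "jordan_matrix bs \<in> carrier_mat n n" "P \<in> carrier_mat n n" "Q \<in> carrier_mat n n"
      using * by auto
    show "map_mat cnj P * map_mat cnj Q = 1\<^sub>m n" "map_mat cnj Q * map_mat cnj P = 1\<^sub>m n"
      using *(2,3) JPQ by (simp_all flip: cnj.mat_hom_mult add: cnj.mat_hom_one)
    show "map_mat cnj A = map_mat cnj P * map_mat cnj (jordan_matrix bs) * map_mat cnj Q"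
      unfolding *(4) using JPQ by (simp add: cnj.mat_hom_mult[of _ n n _ n])
  qed (use * in auto)
  then show ?thesis
    using assms by (force simp: jordan_nf_def J)
qed

text \<open>\<open>bs\<close> and its conjugate are both Jordan forms of the real matrix
  \<open>A\<close>; the blocks for \<open>cnj ev\<close> in the conjugate have the sizes of the
  blocks for \<open>ev\<close> in \<open>bs\<close>.\<close>

lemma dim_gen_eigenspace_cnj:
  assumes "jordan_nf A bs" and "map_mat cnj A = A"
  shows "dim_gen_eigenspace A (cnj ev) k = dim_gen_eigenspace A ev k"
proof -
  have "dim_gen_eigenspace A (cnj ev) k
      = (\<Sum>n\<leftarrow>map fst [(n, e)\<leftarrow>map (apsnd cnj) bs . e = cnj ev]. min k n)"
    using dim_gen_eigenspace[OF jordan_nf_cnj[OF assms(1)]] assms(2) by simp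
  also have "map fst [(n, e)\<leftarrow>map (apsnd cnj) bs . e = cnj ev] = map fst [(n, e)\<leftarrow>bs . e = ev]"
    by (induction bs) auto
  finally show ?thesis
    using dim_gen_eigenspace[OF assms(1)] by simp
qed

text \<open>For positive \<open>k\<close> the number of blocks is a second difference of the
  dimensions of generalized eigenspaces, hence independent of \<open>bs\<close>. Size 0 is separate
  because \<open>jordan_nf\<close> excludes empty blocks.\<close>

lemma count_block_sizes:
  assumes "jordan_nf A bs"
  shows "count (block_sizes bs ev) k = (if k = 0 then 0 else compute_nr_of_jordan_blocks A ev k)"
proof -
  have *: "count (block_sizes bs ev) k = length (filter ((=) (k, ev)) bs)"
    unfolding block_sizes_def by (induction bs) auto
  show ?thesis
  proof (cases "k = 0")
    case True
    then show ?thesis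
      using assms unfolding * by (force simp: jordan_nf_def filter_empty_conv)
  next
    case False
    then show ?thesis
      using compute_nr_of_jordan_blocks[OF assms] * by simp
  qed
qed

lemma block_sizes_eqI:
  assumes "jordan_nf A bs"
    and "\<And>k. dim_gen_eigenspace A a k = dim_gen_eigenspace A b k"
  shows "block_sizes bs a = block_sizes bs b"
  by (rule multiset_eqI)
     (simp add: count_block_sizes[OF assms(1)] compute_nr_of_jordan_blocks_def assms(2))

text \<open>The characteristic polynomial is the product of the powers (x - a)^k over the blocks;
  since every block has positive size, each one contributes a root.\<close>

lemma spectrum_iff_block_sizes:
  assumes "jordan_nf A bs"
  shows "ev \<in> spectrum A \<longleftrightarrow> block_sizes bs ev \<noteq> {#}"
proof -
  obtain n where A: "A \<in> carrier_mat n n"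
    using assms similar_matD unfolding jordan_nf_def by blast
  have "poly (char_poly A) ev = 0 \<longleftrightarrow> (\<exists>(k, a) \<in> set bs. a = ev \<and> k \<noteq> 0)"
    unfolding jordan_nf_char_poly[OF assms]
    by (induction bs) auto
  also have "\<dots> \<longleftrightarrow> block_sizes bs ev \<noteq> {#}"
    using assms unfolding block_sizes_def jordan_nf_def by (force simp: filter_mset_eq_mempty_iff)
  finally show ?thesis
    by (simp add: spectrum_root_char_poly[OF A])
qed

subsection \<open>Matrices anti-intertwined with their transpose\<close>

lemma char_matrix_mult_vec:
  assumes "x \<in> carrier_vec n" and "A \<in> carrier_mat n n"
  shows "char_matrix A a *\<^sub>v x = A *\<^sub>v x - a \<cdot>\<^sub>v x"
  using assms unfolding char_matrix_def
  by (intro eq_vecI) (auto simp: add_mult_distrib_mat_vec[of _ n n] smult_scalar_prod_distrib[of _ n])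

context
  fixes n :: nat and P L :: "'a::field mat" and ev :: 'a
  assumes P: "P \<in> carrier_mat n n" and L: "L \<in> carrier_mat n n"
    and anti: "L * P = - (P\<^sup>T * L)"
begin

text \<open>This is L (P - ev) = - (P^T + ev) L read on vectors; the sign in \<open>anti\<close> is
  what turns \<open>ev\<close> into \<open>- ev\<close>.\<close>

lemma char_matrix_intertwine:
  assumes x: "x \<in> carrier_vec n"
  shows "L *\<^sub>v (char_matrix P ev *\<^sub>v x) = - 1 \<cdot>\<^sub>v (char_matrix P\<^sup>T (- ev) *\<^sub>v (L *\<^sub>v x))"
proof -
  have "L *\<^sub>v (char_matrix P ev *\<^sub>v x) = L *\<^sub>v (P *\<^sub>v x) - ev \<cdot>\<^sub>v (L *\<^sub>v x)"
    using P L x by (simp add: char_matrix_mult_vec[of _ n] mult_minus_distrib_mat_vec[of _ n n] mult_mat_vec[of _ n n])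
  also have "L *\<^sub>v (P *\<^sub>v x) = - (P\<^sup>T *\<^sub>v (L *\<^sub>v x))"
  proof -
    have "L *\<^sub>v (P *\<^sub>v x) = (- (P\<^sup>T * L)) *\<^sub>v x"
      using P L x by (simp flip: anti add: assoc_mult_mat_vec[of _ n n _ n])
    then show ?thesis
      using P L x by (simp add: assoc_mult_mat_vec[of _ n n _ n] uminus_mult_mat_vec)
  qed
  finally show ?thesis
    using P L x by (intro eq_vecI) (auto simp: char_matrix_mult_vec[of _ n])
qed

text \<open>Each factor of the power passes through \<open>L\<close> at the cost of a sign, which
  does not affect whether the result vanishes.\<close>

lemma gen_eigenspace_to_transpose:
  assumes "x \<in> carrier_vec n" "char_matrix P ev ^\<^sub>m k *\<^sub>v x = 0\<^sub>v n"
  shows "char_matrix P\<^sup>T (- ev) ^\<^sub>m k *\<^sub>v (L *\<^sub>v x) = 0\<^sub>v n"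
  using assms
proof (induction k arbitrary: x)
  case 0
  then show ?case using P L by (auto simp: char_matrix_def)
next
  case (Suc k)
  let ?C = "char_matrix P ev" and ?D = "char_matrix P\<^sup>T (- ev)"
  have C: "?C \<in> carrier_mat n n" and D: "?D \<in> carrier_mat n n" using P by auto
  have Ck: "?C ^\<^sub>m k \<in> carrier_mat n n" and Dk: "?D ^\<^sub>m k \<in> carrier_mat n n" using C D by auto
  have Lx: "L *\<^sub>v x \<in> carrier_vec n" using L Suc.prems by auto
  have "?C ^\<^sub>m k *\<^sub>v (?C *\<^sub>v x) = 0\<^sub>v n"
    using Suc.prems C Ck by (simp add: assoc_mult_mat_vec[of _ n n _ n])
  then have "?D ^\<^sub>m k *\<^sub>v (L *\<^sub>v (?C *\<^sub>v x)) = 0\<^sub>v n"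
    by (intro Suc.IH) (use C Suc.prems in auto)
  then have "?D ^\<^sub>m k *\<^sub>v (- 1 \<cdot>\<^sub>v (?D *\<^sub>v (L *\<^sub>v x))) = 0\<^sub>v n"
    using char_matrix_intertwine[OF Suc.prems(1)] by simp
  then have "- 1 \<cdot>\<^sub>v (?D ^\<^sub>m k *\<^sub>v (?D *\<^sub>v (L *\<^sub>v x))) = 0\<^sub>v n"
    using D Dk Lx by (simp add: mult_mat_vec[of _ n n])
  then show ?case
    using D Dk Lx by (auto simp: assoc_mult_mat_vec[of _ n n _ n] vec_eq_iff)
qed

text \<open>By the intertwining relation the kernel of \<open>L\<close> is invariant under
  \<open>char_matrix P ev\<close>. Lowering the power leads to P x = ev x with x in that kernel,
  where P^2 = - 1 would force ev^2 = - 1 if x were nonzero.\<close>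

lemma gen_eigenspace_inter_kernel:
  assumes sq: "\<And>x. x \<in> carrier_vec n \<Longrightarrow> L *\<^sub>v x = 0\<^sub>v n \<Longrightarrow> P *\<^sub>v (P *\<^sub>v x) = - x"
    and ev: "ev\<^sup>2 \<noteq> - 1"
    and "x \<in> carrier_vec n" "char_matrix P ev ^\<^sub>m k *\<^sub>v x = 0\<^sub>v n" "L *\<^sub>v x = 0\<^sub>v n"
  shows "x = 0\<^sub>v n"
  using assms(3-5)
proof (induction k arbitrary: x)
  case 0
  then show ?case using P by (auto simp: char_matrix_def)
next
  case (Suc k)
  let ?C = "char_matrix P ev"
  have C: "?C \<in> carrier_mat n n" using P by auto
  have Ck: "?C ^\<^sub>m k \<in> carrier_mat n n" using C by auto
  have x: "x \<in> carrier_vec n" by (rule Suc.prems)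
  have "?C *\<^sub>v x = 0\<^sub>v n"
  proof (rule Suc.IH)
    show "?C ^\<^sub>m k *\<^sub>v (?C *\<^sub>v x) = 0\<^sub>v n"
      using Suc.prems C Ck by (simp add: assoc_mult_mat_vec[of _ n n _ n])
    have "char_matrix P\<^sup>T (- ev) *\<^sub>v 0\<^sub>v n = 0\<^sub>v n"
      using P by (intro eq_vecI) (auto simp: char_matrix_def)
    moreover have "- 1 \<cdot>\<^sub>v 0\<^sub>v n = (0\<^sub>v n :: 'a vec)"
      by (intro eq_vecI) auto
    ultimately show "L *\<^sub>v (?C *\<^sub>v x) = 0\<^sub>v n"
      using char_matrix_intertwine[OF x] Suc.prems(3) by simp
  qed (use C x in auto)
  then have "P *\<^sub>v x - ev \<cdot>\<^sub>v x = 0\<^sub>v n"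
    using P x by (simp add: char_matrix_mult_vec[of _ n])
  then have Px: "P *\<^sub>v x = ev \<cdot>\<^sub>v x"
    using P x by (auto simp: vec_eq_iff)
  have "- x = P *\<^sub>v (P *\<^sub>v x)"
    using sq[OF x Suc.prems(3)] by simp
  also have "\<dots> = ev\<^sup>2 \<cdot>\<^sub>v x"
    using P x by (simp add: Px mult_mat_vec[of _ n n] smult_smult_assoc power2_eq_square)
  finally have "- x = ev\<^sup>2 \<cdot>\<^sub>v x" .
  then have sq_entry: "ev\<^sup>2 * x $ i = - (x $ i)" if "i < n" for i
    using x that by (auto simp: vec_eq_iff)
  have "(ev\<^sup>2 + 1) * x $ i = 0" if "i < n" for i
    using sq_entry[OF that] by (simp add: distrib_right)
  then have "x $ i = 0" if "i < n" for i
    using ev that by (metis add_eq_0_iff2 mult_eq_0_iff)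
  then show ?case using x by auto
qed

lemma dim_gen_eigenspace_le_transpose:
  assumes "\<And>x. x \<in> carrier_vec n \<Longrightarrow> L *\<^sub>v x = 0\<^sub>v n \<Longrightarrow> P *\<^sub>v (P *\<^sub>v x) = - x"
    and "ev\<^sup>2 \<noteq> - 1"
  shows "dim_gen_eigenspace P ev k \<le> dim_gen_eigenspace P\<^sup>T (- ev) k"
  unfolding dim_gen_eigenspace_def
proof (rule kernel_dim_le_of_injective[OF _ _ L])
  show C: "char_matrix P ev ^\<^sub>m k \<in> carrier_mat n n" and D: "char_matrix P\<^sup>T (- ev) ^\<^sub>m k \<in> carrier_mat n n"
    using P by auto
  fix x assume "x \<in> mat_kernel (char_matrix P ev ^\<^sub>m k)"
  note x = mat_kernelD[OF C this]
  show "L *\<^sub>v x \<in> mat_kernel (char_matrix P\<^sup>T (- ev) ^\<^sub>m k)"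
    using L x gen_eigenspace_to_transpose by (intro mat_kernelI[OF D]) auto
  show "L *\<^sub>v x = 0\<^sub>v n \<Longrightarrow> x = 0\<^sub>v n"
    using gen_eigenspace_inter_kernel[OF assms x] .
qed

end

subsection \<open>The vertices of a cooriented polygon\<close>

definition cyc_succ :: "nat \<Rightarrow> nat \<Rightarrow> nat" where
  "cyc_succ n j = Suc j mod n"

text \<open>Adding \<open>n\<close> first avoids truncated subtraction at \<open>j = 0\<close>; the
  expression is the one in \<open>evolute_map\<close>.\<close>

definition cyc_pred :: "nat \<Rightarrow> nat \<Rightarrow> nat" where
  "cyc_pred n j = (j + n - 1) mod n"

lemma cyc_pred_succ: "j < n \<Longrightarrow> cyc_pred n (cyc_succ n j) = j"
  by (cases "Suc j = n") (auto simp: cyc_pred_def cyc_succ_def)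

lemma cyc_succ_pred: "j < n \<Longrightarrow> cyc_succ n (cyc_pred n j) = j"
  by (cases j) (auto simp: cyc_pred_def cyc_succ_def)

lemma cyc_less: "j < n \<Longrightarrow> cyc_succ n j < n" "j < n \<Longrightarrow> cyc_pred n j < n"
  by (auto simp: cyc_pred_def cyc_succ_def)

lemma sum_cyc_succ:
  "(\<Sum>j = 0..<n. f (cyc_succ n j)) = (\<Sum>j = 0..<n. f j)"
  by (rule sum.reindex_bij_witness[of _ "cyc_pred n" "cyc_succ n"])
     (auto simp: cyc_pred_succ cyc_succ_pred cyc_less)

lemma sum_of_bool_mult:
  fixes f :: "nat \<Rightarrow> 'a::field"
  shows "m < n \<Longrightarrow> (\<Sum>j = 0..<n. of_bool (j = m) * f j) = f m"
  by (simp add: of_bool_def if_distrib[of "\<lambda>t. t * _"] cong: if_cong)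

text \<open>
  Here \<open>c j\<close> and \<open>s j\<close> stand for the cosine and sine of the turning angle from side \<open>j\<close> to side
  \<open>j + 1\<close>; the two matrices are \<open>F\<close> and \<open>G\<close> above.
\<close>

definition next_vertex :: "nat \<Rightarrow> (nat \<Rightarrow> 'a) \<Rightarrow> (nat \<Rightarrow> 'a) \<Rightarrow> 'a::field mat" where
  "next_vertex n c s = mat n n (\<lambda>(i, j). (of_bool (j = cyc_succ n i) - c i * of_bool (j = i)) / s i)"

definition prev_vertex :: "nat \<Rightarrow> (nat \<Rightarrow> 'a) \<Rightarrow> (nat \<Rightarrow> 'a) \<Rightarrow> 'a::field mat" where
  "prev_vertex n c s = mat n n (\<lambda>(i, j). (c (cyc_pred n i) * of_bool (j = i) - of_bool (j = cyc_pred n i))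
     / s (cyc_pred n i))"

lemma vertex_mat_dims [simp]:
  "next_vertex n c s \<in> carrier_mat n n" "dim_row (next_vertex n c s) = n" "dim_col (next_vertex n c s) = n"
  "prev_vertex n c s \<in> carrier_mat n n" "dim_row (prev_vertex n c s) = n" "dim_col (prev_vertex n c s) = n"
  by (simp_all add: next_vertex_def prev_vertex_def)

context
  fixes n :: nat and c s :: "nat \<Rightarrow> 'a::field"
  assumes s0: "\<And>j. j < n \<Longrightarrow> s j \<noteq> 0"
    and cs: "\<And>j. j < n \<Longrightarrow> (c j)\<^sup>2 + (s j)\<^sup>2 = 1"
begin

text \<open>In the frame of side i the vertex is (x_i, t), and the next side has normal (c_i, s_i).
  Solving c_i x_i + s_i t = x_(i+1) for t gives the formula.\<close>

lemma next_vertex_mult_vec: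
  assumes "x \<in> carrier_vec n" "i < n"
  shows "(next_vertex n c s *\<^sub>v x) $ i = (x $ cyc_succ n i - c i * x $ i) / s i"
proof -
  have "(next_vertex n c s *\<^sub>v x) $ i = (\<Sum>j = 0..<n. of_bool (j = cyc_succ n i) * (x $ j / s i))
      - (\<Sum>j = 0..<n. of_bool (j = i) * (c i * x $ j / s i))"
    using assms unfolding sum_subtractf[symmetric]
    by (auto simp: next_vertex_def scalar_prod_def diff_divide_distrib left_diff_distrib intro!: sum.cong)
  then show ?thesis
    using assms by (simp only: sum_of_bool_mult cyc_less diff_divide_distrib)
qed

text \<open>Likewise, the previous side has normal (c, - s) in the frame of side i, with c and s
  taken at the predecessor, so c x_i - s t = x_(i-1).\<close>

lemma prev_vertex_mult_vec:
  assumes "x \<in> carrier_vec n" "i < n"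
  shows "(prev_vertex n c s *\<^sub>v x) $ i = (c (cyc_pred n i) * x $ i - x $ cyc_pred n i) / s (cyc_pred n i)"
proof -
  have "(prev_vertex n c s *\<^sub>v x) $ i = (\<Sum>j = 0..<n. of_bool (j = i) * (c (cyc_pred n i) * x $ j / s (cyc_pred n i)))
      - (\<Sum>j = 0..<n. of_bool (j = cyc_pred n i) * (x $ j / s (cyc_pred n i)))"
    using assms unfolding sum_subtractf[symmetric]
    by (auto simp: prev_vertex_def scalar_prod_def diff_divide_distrib left_diff_distrib intro!: sum.cong)
  then show ?thesis
    using assms by (simp only: sum_of_bool_mult cyc_less diff_divide_distrib)
qed

text \<open>The off-diagonal weight 1 / s_i belongs to the vertex joining sides i and i + 1: row i
  receives it from \<open>next_vertex\<close>, row i + 1 from \<open>prev_vertex\<close>.\<close>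

lemma side_length_mat_symmetric: "(next_vertex n c s - prev_vertex n c s)\<^sup>T = next_vertex n c s - prev_vertex n c s"
proof (rule eq_matI)
  fix i j assume "i < dim_row (next_vertex n c s - prev_vertex n c s)" "j < dim_col (next_vertex n c s - prev_vertex n c s)"
  then have ij: "i < n" "j < n" by (simp_all add: prev_vertex_def)
  \<comment> \<open>Separate indicators for the two neighbours keep the formula valid even when they
    coincide.\<close>
  have entry: "(next_vertex n c s - prev_vertex n c s) $$ (i, j) = of_bool (j = cyc_succ n i) / s i
      + of_bool (j = cyc_pred n i) / s (cyc_pred n i)
      - of_bool (i = j) * (c i / s i + c (cyc_pred n i) / s (cyc_pred n i))" if "i < n" "j < n" for i j
    using that by (auto simp: next_vertex_def prev_vertex_def diff_divide_distrib simp del: of_bool_eq)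
  have swap: "of_bool (j = cyc_succ n i) / s i = of_bool (i = cyc_pred n j) / s (cyc_pred n j)"
    if "i < n" "j < n" for i j
    using that by (cases "j = cyc_succ n i") (auto simp: cyc_pred_succ cyc_succ_pred)
  have diag: "of_bool (j = i) * (c j / s j + c (cyc_pred n j) / s (cyc_pred n j))
      = of_bool (i = j) * (c i / s i + c (cyc_pred n i) / s (cyc_pred n i))"
    by (cases "i = j") simp_all
  have "(next_vertex n c s - prev_vertex n c s)\<^sup>T $$ (i, j) = (next_vertex n c s - prev_vertex n c s) $$ (j, i)"
    using ij by (simp del: index_minus_mat(1))
  also have "\<dots> = (next_vertex n c s - prev_vertex n c s) $$ (i, j)"
    unfolding entry[OF ij] entry[OF ij(2,1)] swap[OF ij] swap[OF ij(2,1)] diag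
    by (simp only: add.commute)
  finally show "(next_vertex n c s - prev_vertex n c s)\<^sup>T $$ (i, j) = (next_vertex n c s - prev_vertex n c s) $$ (i, j)" .
qed (auto simp: prev_vertex_def)

text \<open>Seen from its two sides, the vertex has squared norm p_k^2 + F_k^2 and p_(k+1)^2 +
  G_(k+1)^2. Summed over the cycle, the squares of the support numbers cancel.\<close>

lemma vertex_mat_gram_eq: "(next_vertex n c s)\<^sup>T * next_vertex n c s = (prev_vertex n c s)\<^sup>T * prev_vertex n c s"
proof (rule eq_matI)
  fix x y assume "x < dim_row ((prev_vertex n c s)\<^sup>T * prev_vertex n c s)" "y < dim_col ((prev_vertex n c s)\<^sup>T * prev_vertex n c s)"
  then have xy: "x < n" "y < n" by (simp_all add: prev_vertex_def)
  define d where "d i j = (of_bool (j = i) :: 'a)" for i j :: nat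
  \<comment> \<open>Both sides are the polarized squared distance of a vertex from the origin.\<close>
  have vertex: "next_vertex n c s $$ (k, x) * next_vertex n c s $$ (k, y) + d k x * d k y
      = prev_vertex n c s $$ (cyc_succ n k, x) * prev_vertex n c s $$ (cyc_succ n k, y) + d (cyc_succ n k) x * d (cyc_succ n k) y"
    if k: "k < n" for k
  proof -
    have s2: "s k * s k = 1 - c k * c k"
      using cs[OF k] by (simp add: power2_eq_square algebra_simps)
    \<comment> \<open>Here \<open>a\<close> and \<open>b\<close> are the values on sides k and k +
      1; after multiplication by \<open>s k * s k\<close> this is a polynomial identity modulo c^2 +
      s^2 = 1.\<close>
    have alg: "(b - c k * a) / s k * ((b' - c k * a') / s k) + a * a'
      = (c k * b - a) / s k * ((c k * b' - a') / s k) + b * b'" for a a' b b'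
    proof -
      have "(b - c k * a) * (b' - c k * a') + (s k * s k) * (a * a')
        = (c k * b - a) * (c k * b' - a') + (s k * s k) * (b * b')"
        by (simp add: s2 algebra_simps)
      then show ?thesis
        using s0[OF k] by (simp add: field_simps power2_eq_square)
    qed
    show ?thesis
      using k xy alg[of "d (cyc_succ n k) x" "d k x" "d (cyc_succ n k) y" "d k y"]
      by (simp add: next_vertex_def prev_vertex_def cyc_pred_succ cyc_less flip: d_def)
  qed
  \<comment> \<open>Shifting the index on the right makes both summands refer to the vertex between
    sides k and k + 1.\<close>
  have "(\<Sum>k = 0..<n. next_vertex n c s $$ (k, x) * next_vertex n c s $$ (k, y)) + (\<Sum>k = 0..<n. d k x * d k y)
     = (\<Sum>k = 0..<n. prev_vertex n c s $$ (k, x) * prev_vertex n c s $$ (k, y)) + (\<Sum>k = 0..<n. d k x * d k y)"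
    unfolding sum.distrib[symmetric]
    by (subst (2) sum_cyc_succ[symmetric]) (simp add: vertex)
  then show "((next_vertex n c s)\<^sup>T * next_vertex n c s) $$ (x, y) = ((prev_vertex n c s)\<^sup>T * prev_vertex n c s) $$ (x, y)"
    using xy by (simp add: scalar_prod_def)
qed (auto simp: next_vertex_def prev_vertex_def)

text \<open>Geometrically, all sides pass through one point; its coordinates along the normals are
  \<open>x\<close>, those along the sides are the common image. A second application completes a
  half turn.\<close>

lemma vertex_mat_on_kernel:
  assumes x: "x \<in> carrier_vec n" and eq: "next_vertex n c s *\<^sub>v x = prev_vertex n c s *\<^sub>v x"
  shows "next_vertex n c s *\<^sub>v (next_vertex n c s *\<^sub>v x) = - x" "prev_vertex n c s *\<^sub>v (next_vertex n c s *\<^sub>v x) = - x"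
proof -
  define q where "q = next_vertex n c s *\<^sub>v x"
  have q: "q \<in> carrier_vec n"
    unfolding q_def by (rule mult_mat_vec_carrier[OF _ x]) simp
  have qj: "q $ j = (x $ cyc_succ n j - c j * x $ j) / s j" if "j < n" for j
    using next_vertex_mult_vec[OF x that] by (simp only: q_def)
  \<comment> \<open>By \<open>eq\<close>, \<open>q\<close> is also the image under
    \<open>prev_vertex\<close>, so the same vertex expresses its value on the next side. The two
    equations can then be solved back for \<open>x\<close>.\<close>
  have qs: "q $ cyc_succ n j = (c j * x $ cyc_succ n j - x $ j) / s j" if "j < n" for j
    using prev_vertex_mult_vec[OF x cyc_less(1)[OF that]] by (simp only: q_def eq cyc_pred_succ[OF that])
  have 1: "(q $ cyc_succ n j - c j * q $ j) / s j = - x $ j" if "j < n" for j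
  proof -
    have e: "q $ cyc_succ n j * s j = c j * x $ cyc_succ n j - x $ j"
      "q $ j * s j = x $ cyc_succ n j - c j * x $ j"
      using qj[OF that] qs[OF that] s0[OF that] by simp_all
    have "q $ cyc_succ n j * s j - c j * (q $ j * s j) = - x $ j * (1 - c j * c j)"
      unfolding e by (simp add: algebra_simps)
    also have "1 - c j * c j = s j * s j"
      using cs[OF that] by (simp add: power2_eq_square algebra_simps)
    finally have "s j * (q $ cyc_succ n j - c j * q $ j) = s j * (- x $ j * s j)"
      by (simp add: algebra_simps)
    then have "q $ cyc_succ n j - c j * q $ j = - x $ j * s j"
      using s0[OF that] by (rule mult_left_cancel[THEN iffD1, rotated])
    then show ?thesis
      using s0[OF that] by simp
  qed
  have 2: "(c j * q $ cyc_succ n j - q $ j) / s j = - x $ cyc_succ n j" if "j < n" for j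
  proof -
    have e: "q $ cyc_succ n j * s j = c j * x $ cyc_succ n j - x $ j"
      "q $ j * s j = x $ cyc_succ n j - c j * x $ j"
      using qj[OF that] qs[OF that] s0[OF that] by simp_all
    have "c j * (q $ cyc_succ n j * s j) - q $ j * s j = - x $ cyc_succ n j * (1 - c j * c j)"
      unfolding e by (simp add: algebra_simps)
    also have "1 - c j * c j = s j * s j"
      using cs[OF that] by (simp add: power2_eq_square algebra_simps)
    finally have "s j * (c j * q $ cyc_succ n j - q $ j) = s j * (- x $ cyc_succ n j * s j)"
      by (simp add: algebra_simps)
    then have "c j * q $ cyc_succ n j - q $ j = - x $ cyc_succ n j * s j"
      using s0[OF that] by (rule mult_left_cancel[THEN iffD1, rotated])
    then show ?thesis
      using s0[OF that] by simp
  qed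
  have "(next_vertex n c s *\<^sub>v q) $ i = (- x) $ i" if "i < n" for i
    using that x by (simp only: next_vertex_mult_vec[OF q that] 1) simp
  then show "next_vertex n c s *\<^sub>v (next_vertex n c s *\<^sub>v x) = - x"
    unfolding q_def[symmetric] using x by (intro eq_vecI) auto
  have "(prev_vertex n c s *\<^sub>v q) $ i = (- x) $ i" if "i < n" for i
    \<comment> \<open>Row i of \<open>prev_vertex\<close> concerns the vertex before side i, so
      \<open>2\<close> is read at the predecessor.\<close>
    using 2[OF cyc_less(2)[OF that]] that x
    by (simp only: prev_vertex_mult_vec[OF q that] cyc_succ_pred) simp
  then show "prev_vertex n c s *\<^sub>v (next_vertex n c s *\<^sub>v x) = - x"
    unfolding q_def[symmetric] using x by (intro eq_vecI) auto
qed

lemma transpose_smult_mat: "(a \<cdot>\<^sub>m A)\<^sup>T = a \<cdot>\<^sub>m A\<^sup>T"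
  by (rule eq_matI) auto

text \<open>Write F, G for the two matrices. By symmetry the first factor of (F - G)(F + G) may be
  transposed; since F^T F = G^T G, only F^T G - G^T F remains, while (F + G)^T (F - G) leaves its
  negative.\<close>

lemma side_length_mat_anti_intertwining:
  fixes P :: "'a mat"
  assumes P: "P = a \<cdot>\<^sub>m (next_vertex n c s + prev_vertex n c s)"
  shows "(next_vertex n c s - prev_vertex n c s) * P = - (P\<^sup>T * (next_vertex n c s - prev_vertex n c s))"
proof -
  define A where "A = (next_vertex n c s)\<^sup>T * next_vertex n c s"
  define B where "B = (next_vertex n c s)\<^sup>T * prev_vertex n c s"
  define C where "C = (prev_vertex n c s)\<^sup>T * next_vertex n c s"
  have D: "(prev_vertex n c s)\<^sup>T * prev_vertex n c s = A"
    by (simp add: A_def vertex_mat_gram_eq)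
  have ABC: "A \<in> carrier_mat n n" "B \<in> carrier_mat n n" "C \<in> carrier_mat n n"
    by (auto simp: A_def B_def C_def)
  have "(next_vertex n c s - prev_vertex n c s) * P = a \<cdot>\<^sub>m ((next_vertex n c s - prev_vertex n c s) * (next_vertex n c s + prev_vertex n c s))"
    unfolding P by (rule mult_smult_distrib) auto
  also have "(next_vertex n c s - prev_vertex n c s) * (next_vertex n c s + prev_vertex n c s) = (A + B) - (C + A)"
    by (subst side_length_mat_symmetric[symmetric])
       (simp add: transpose_minus[of _ n n] minus_mult_distrib_mat[of _ n n _ _ n]
         mult_add_distrib_mat[of _ n n _ n] D flip: A_def B_def C_def)
  finally have 1: "(next_vertex n c s - prev_vertex n c s) * P = a \<cdot>\<^sub>m ((A + B) - (C + A))" .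
  have "P\<^sup>T * (next_vertex n c s - prev_vertex n c s) = a \<cdot>\<^sub>m ((next_vertex n c s + prev_vertex n c s)\<^sup>T * (next_vertex n c s - prev_vertex n c s))"
    unfolding P transpose_smult_mat by (rule mult_smult_assoc_mat[of _ n n _ n]) auto
  also have "(next_vertex n c s + prev_vertex n c s)\<^sup>T * (next_vertex n c s - prev_vertex n c s) = (A + C) - (B + A)"
    by (simp add: transpose_add[of _ n n] add_mult_distrib_mat[of _ n n _ _ n]
      mult_minus_distrib_mat[of _ n n _ n] D flip: A_def B_def C_def)
  finally have 2: "P\<^sup>T * (next_vertex n c s - prev_vertex n c s) = a \<cdot>\<^sub>m ((A + C) - (B + A))" .
  show ?thesis
    unfolding 1 2 using ABC by (intro eq_matI) (auto simp: algebra_simps)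
qed

text \<open>On the kernel both vertex matrices agree, so their mean \<open>P\<close> acts as
  \<open>next_vertex\<close>; on the image each of the two gives - x, and so does the mean.\<close>

lemma evolute_square_on_kernel:
  fixes P :: "'a mat"
  assumes P: "P = (1 / 2) \<cdot>\<^sub>m (next_vertex n c s + prev_vertex n c s)" and two: "(2 :: 'a) \<noteq> 0"
    and x: "x \<in> carrier_vec n" and "(next_vertex n c s - prev_vertex n c s) *\<^sub>v x = 0\<^sub>v n"
  shows "P *\<^sub>v (P *\<^sub>v x) = - x"
proof -
  have half: "P *\<^sub>v y = (1 / 2) \<cdot>\<^sub>v (next_vertex n c s *\<^sub>v y + prev_vertex n c s *\<^sub>v y)" if "y \<in> carrier_vec n" for y
    using that
    by (intro eq_vecI) (auto simp: P smult_scalar_prod_distrib[of _ n] add_scalar_prod_distrib[of _ n])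
  have avg: "(1 / 2) \<cdot>\<^sub>v (y + y) = y" for y :: "'a vec"
    using two by (intro eq_vecI) (auto simp: field_simps)
  have "next_vertex n c s *\<^sub>v x - prev_vertex n c s *\<^sub>v x = 0\<^sub>v n"
    using assms(4) x by (simp add: minus_mult_distrib_mat_vec[of _ n n])
  then have eq: "next_vertex n c s *\<^sub>v x = prev_vertex n c s *\<^sub>v x"
    using x by (auto simp: vec_eq_iff)
  have Px: "P *\<^sub>v x = next_vertex n c s *\<^sub>v x"
    unfolding half[OF x] eq[symmetric] by (rule avg)
  have "next_vertex n c s *\<^sub>v x \<in> carrier_vec n"
    by (rule mult_mat_vec_carrier[OF _ x]) simp
  then show ?thesis
    by (simp add: Px half vertex_mat_on_kernel[OF x eq] avg)
qed

end

subsection \<open>The spectrum of the evolute map\<close>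

text \<open>The perpendicular bisector has the direction of the side as its normal, so its support
  number is the signed coordinate of the midpoint, the mean of those of the two vertices.\<close>

lemma evolute_mat_eq:
  "evolute_mat n \<theta> = (1 / 2) \<cdot>\<^sub>m
     (next_vertex n (\<lambda>j. complex_of_real (cos (\<theta> j))) (\<lambda>j. complex_of_real (sin (\<theta> j)))
    + prev_vertex n (\<lambda>j. complex_of_real (cos (\<theta> j))) (\<lambda>j. complex_of_real (sin (\<theta> j))))"
proof (rule eq_matI, goal_cases)
  case (1 i j)
  then have ij: "i < n" "j < n" by (simp_all add: prev_vertex_def)
  have unit: "unit_vec n j $ k = (of_bool (j = k) :: real)" if "k < n" for k
    using ij that by auto
  have e: "evolute_map n \<theta> (unit_vec n j) $ i = 1 / 2 *
      ((of_bool (j = cyc_succ n i) - cos (\<theta> i) * of_bool (j = i)) / sin (\<theta> i)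
      + (cos (\<theta> (cyc_pred n i)) * of_bool (j = i) - of_bool (j = cyc_pred n i)) / sin (\<theta> (cyc_pred n i)))"
    unfolding evolute_map_def Let_def cyc_succ_def[symmetric] cyc_pred_def[symmetric] index_vec[OF ij(1)]
      unit[OF ij(1)] unit[OF cyc_less(1)[OF ij(1)]] unit[OF cyc_less(2)[OF ij(1)]]
    by (simp add: csc_def cot_def diff_divide_distrib left_diff_distrib)
  have "evolute_mat n \<theta> $$ (i, j) = complex_of_real (evolute_map n \<theta> (unit_vec n j) $ i)"
    using ij by (simp add: evolute_mat_def)
  then show ?case
    unfolding e using ij by (simp add: next_vertex_def prev_vertex_def)
qed (simp_all add: evolute_mat_def prev_vertex_def)

text \<open>Adjacent sides meet in exactly one point, and the sine ignores multiples of 2 pi. This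
  justifies the divisions in the vertex coordinates.\<close>

lemma sin_turning_angle_nonzero:
  assumes "cooriented_polygon n l" "turning_angles n l \<theta>" "j < n"
  shows "sin (\<theta> j) \<noteq> 0"
proof -
  define \<delta> where "\<delta> = fst (l (Suc j mod n)) - fst (l j)"
  have "sin \<delta> \<noteq> 0"
    using assms(1,3) by (simp add: cooriented_polygon_def parallel_lines_iff_sin \<delta>_def)
  moreover obtain k where "\<delta> = \<theta> j + of_int k * (2 * pi)"
    using assms(2,3) unfolding turning_angles_def rcong_altdef \<delta>_def by blast
  then have "sin \<delta> = sin (\<theta> j)"
    by (simp only: mult.commute[of _ "2 * pi"] sin_add sin_int_2pin cos_int_2pin mult_1_right mult_zero_right add_0_right)
  ultimately show ?thesis by simp
qed

lemma evolute_mat_dim_gen_eigenspace: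
  assumes "cooriented_polygon n l" and "turning_angles n l \<theta>"
  shows "dim_gen_eigenspace (evolute_mat n \<theta>) (- ev) k = dim_gen_eigenspace (evolute_mat n \<theta>) ev k"
proof (cases "ev\<^sup>2 = - 1")
  case True
  then have "(ev - \<i>) * (ev + \<i>) = 0"
    by (simp add: algebra_simps power2_eq_square)
  then have "ev = \<i> \<or> ev = - \<i>"
    by (simp add: add_eq_0_iff2)
  then have ev: "cnj ev = - ev"
    by auto
  have real: "map_mat cnj (evolute_mat n \<theta>) = evolute_mat n \<theta>"
    by (rule eq_matI) (simp_all add: evolute_mat_def)
  obtain bs where "jordan_nf (evolute_mat n \<theta>) bs"
    using evolute_mat_jordan_nf_exists by blast
  from dim_gen_eigenspace_cnj[OF this real, of ev k] show ?thesis
    by (simp only: ev)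
next
  case False
  define P where "P = evolute_mat n \<theta>"
  define c where "c j = complex_of_real (cos (\<theta> j))" for j
  define s where "s j = complex_of_real (sin (\<theta> j))" for j
  have s0: "s j \<noteq> 0" if "j < n" for j
    using sin_turning_angle_nonzero[OF assms that] by (simp add: s_def)
  have cs: "(c j)\<^sup>2 + (s j)\<^sup>2 = 1" if "j < n" for j
    unfolding c_def s_def of_real_power[symmetric] of_real_add[symmetric] by simp
  have P: "P = (1 / 2) \<cdot>\<^sub>m (next_vertex n c s + prev_vertex n c s)"
    unfolding P_def c_def s_def by (rule evolute_mat_eq)
  have Pc: "P \<in> carrier_mat n n" by (simp add: P)
  obtain bs where "jordan_nf P bs"
    using evolute_mat_jordan_nf_exists unfolding P_def by blast
  then have transp: "dim_gen_eigenspace P\<^sup>T = dim_gen_eigenspace P"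
    by (intro dim_gen_eigenspace_similar similar_mat_transpose)
  define L where "L = next_vertex n c s - prev_vertex n c s"
  have L: "L \<in> carrier_mat n n" unfolding L_def by (rule minus_carrier_mat) simp
  have anti: "L * P = - (P\<^sup>T * L)"
    unfolding L_def by (rule side_length_mat_anti_intertwining[of n s c, OF s0 cs P])
  have sq: "P *\<^sub>v (P *\<^sub>v x) = - x" if "x \<in> carrier_vec n" "L *\<^sub>v x = 0\<^sub>v n" for x
    using that unfolding L_def by (intro evolute_square_on_kernel[of n s c, OF s0 cs P]) simp_all
  \<comment> \<open>Similarity removes the transpose from the estimate; using it at both
    \<open>ev\<close> and \<open>- ev\<close> yields equality.\<close>
  have le: "dim_gen_eigenspace P a k \<le> dim_gen_eigenspace P (- a) k" if "a\<^sup>2 \<noteq> - 1" for a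
    using dim_gen_eigenspace_le_transpose[OF Pc L anti sq that, of k] by (simp only: transp)
  show ?thesis
    using le[of ev] le[of "- ev"] False by (simp add: P_def)
qed

theorem theorem7:
  fixes n :: nat and l :: "nat \<Rightarrow> cooriented_line" and \<theta> :: "nat \<Rightarrow> real"
  assumes "n \<ge> 3"
    and "cooriented_polygon n l"
    and "turning_angles n l \<theta>"
  shows "uminus ` spectrum (evolute_mat n \<theta>) = spectrum (evolute_mat n \<theta>)
    \<and> (\<forall>ev \<in> spectrum (evolute_mat n \<theta>).
         geometric_multiplicity (evolute_mat n \<theta>) (- ev) = geometric_multiplicity (evolute_mat n \<theta>) ev
         \<and> (\<forall>bs. jordan_nf (evolute_mat n \<theta>) bs \<longrightarrow> block_sizes bs (- ev) = block_sizes bs ev))"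
proof -
  let ?P = "evolute_mat n \<theta>"
  note dim = evolute_mat_dim_gen_eigenspace[OF assms(2,3)]
  have blocks: "block_sizes bs (- ev) = block_sizes bs ev" if "jordan_nf ?P bs" for bs ev
    by (rule block_sizes_eqI[OF that dim])
  obtain bs where bs: "jordan_nf ?P bs"
    using evolute_mat_jordan_nf_exists by blast
  have "- ev \<in> spectrum ?P \<longleftrightarrow> ev \<in> spectrum ?P" for ev
    by (simp add: spectrum_iff_block_sizes[OF bs] blocks[OF bs])
  then have "uminus ` spectrum ?P = spectrum ?P"
    by (auto simp: image_iff) (metis minus_minus)
  \<comment> \<open>The geometric multiplicity is the first term of the sequence of dimensions
    already compared.\<close>
  moreover have "geometric_multiplicity ?P ev = dim_gen_eigenspace ?P ev 1" for ev
    by (simp add: geometric_multiplicity_def dim_gen_eigenspace_def char_matrix_def evolute_mat_def)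
  ultimately show ?thesis
    using blocks dim by simp
qed

end
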